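(* Let $p$ be an odd prime. Suppose that $\alpha\in\mathbb Z_p$ and $\langle-\alpha\rangle_p$ is even. Then for any $z\in\mathbb Z_p$, $$ {}_2F_1\bigg[\begin{matrix}\alpha&1-\alpha\\&1\end{matrix}\bigg|\,z\bigg]_{p-1}\equiv{}_2F_1\bigg[\begin{matrix}\frac12\alpha&\frac12-\frac12\alpha\\&1\end{matrix}\bigg|\,4z(1-z)\bigg]_{p-1}\pmod{p^2}. $$
   Context: $\mathbb Z_p$ denotes the $p$-adic integers. For $\alpha\in\mathbb Z_p$, $\langle\alpha\rangle_p$ is the unique integer in $\{0,1,\ldots,p-1\}$ congruent to $\alpha$ modulo $p$. Pochhammer symbol: $(x)_0=1$, $(x)_k=x(x+1)\cdots(x+k-1)$. For $n\ge 0$, ${}_{2}F_1\Big[\begin{matrix}\alpha&\beta\\&\gamma\end{matrix}\Big|\,z\Big]_n=\sum_{k=0}^{n}\frac{(\alpha)_k(\beta)_k}{(\gamma)_k}\cdot\frac{z^k}{k!}$. For $x,y\in\mathbb Z_p$, $x\equiv y\pmod{p^2}$ means $x-y\in p^2\mathbb Z_p$. *)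

theory Defs
  imports
    "HOL-Computational_Algebra.Computational_Algebra"
    "Berlekamp_Zassenhaus.Finite_Field"
begin

section \<open>The $p$-adic integers\<close>

text \<open>
  The prime $p$ is the cardinality of the type parameter \<open>'p\<close>, which ranges over the types of
  prime cardinality. The type \<open>'p padic_int\<close> is the inverse limit of the rings
  $\mathbb{Z}/p^n\mathbb{Z}$: an element is a compatible family of residues, each represented in
  $\{0,\dots,p^n-1\}$.
\<close>

typedef (overloaded) ('p :: prime_card) padic_int =
  "{x :: nat \<Rightarrow> int. (\<forall>n. x n \<in> {0..<int CARD('p) ^ n}) \<and>
                    (\<forall>n. x (Suc n) mod int CARD('p) ^ n = x n)}"
  by (rule exI[of _ "\<lambda>_. 0"]) (use prime_card[where 'a = 'p] in \<open>auto simp: prime_gt_0_nat\<close>)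

setup_lifting type_definition_padic_int

lemma prime_card_pos [simp]: "0 < int CARD('p::prime_card) ^ n"
  using prime_card[where 'a = 'p] by (simp add: prime_gt_0_nat)

lemma mod_family_padic:
  fixes f :: "nat \<Rightarrow> int"
  assumes "\<And>n. [f (Suc n) = f n] (mod int CARD('p::prime_card) ^ n)"
  shows "(\<forall>n. f n mod int CARD('p) ^ n \<in> {0..<int CARD('p) ^ n}) \<and>
         (\<forall>n. f (Suc n) mod int CARD('p) ^ Suc n mod int CARD('p) ^ n = f n mod int CARD('p) ^ n)"
  using assms by (auto simp: cong_def mod_mod_cancel)

lemma padic_int_cong:
  assumes "\<forall>n. x (Suc n) mod int CARD('p::prime_card) ^ n = x n"
  shows "[x (Suc n) = x n] (mod int CARD('p) ^ n)"
  using assms by (metis cong_def mod_mod_trivial)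

instantiation padic_int :: (prime_card) comm_ring_1
begin

lift_definition zero_padic_int :: "'a padic_int" is "\<lambda>n. 0 mod int CARD('a) ^ n"
  by (rule mod_family_padic) simp

lift_definition one_padic_int :: "'a padic_int" is "\<lambda>n. 1 mod int CARD('a) ^ n"
  by (rule mod_family_padic) simp

lift_definition plus_padic_int :: "'a padic_int \<Rightarrow> 'a padic_int \<Rightarrow> 'a padic_int"
  is "\<lambda>x y n. (x n + y n) mod int CARD('a) ^ n"
  by (rule mod_family_padic) (intro cong_add padic_int_cong; blast)

lift_definition minus_padic_int :: "'a padic_int \<Rightarrow> 'a padic_int \<Rightarrow> 'a padic_int"
  is "\<lambda>x y n. (x n - y n) mod int CARD('a) ^ n"
  by (rule mod_family_padic) (intro cong_diff padic_int_cong; blast)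

lift_definition uminus_padic_int :: "'a padic_int \<Rightarrow> 'a padic_int"
  is "\<lambda>x n. (- x n) mod int CARD('a) ^ n"
  by (rule mod_family_padic) (simp add: cong_minus_minus_iff padic_int_cong)

lift_definition times_padic_int :: "'a padic_int \<Rightarrow> 'a padic_int \<Rightarrow> 'a padic_int"
  is "\<lambda>x y n. (x n * y n) mod int CARD('a) ^ n"
  by (rule mod_family_padic) (intro cong_mult padic_int_cong; blast)

instance
proof
  fix a b c :: "'a padic_int"
  show "a * b * c = a * (b * c)"
    by transfer (auto simp: fun_eq_iff mod_simps mult.assoc)
  show "a * b = b * a"
    by transfer (auto simp: fun_eq_iff mult.commute)
  show "1 * a = a"
    by transfer (auto simp: fun_eq_iff mod_simps)
  show "a + b + c = a + (b + c)"
    by transfer (auto simp: fun_eq_iff mod_simps add.assoc)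
  show "a + b = b + a"
    by transfer (auto simp: fun_eq_iff add.commute)
  show "0 + a = a"
    by transfer (auto simp: fun_eq_iff mod_simps)
  show "- a + a = 0"
    by transfer (auto simp: fun_eq_iff mod_simps)
  show "a - b = a + - b"
    by transfer (auto simp: fun_eq_iff mod_simps)
  show "(a + b) * c = a * c + b * c"
    by transfer (auto simp: fun_eq_iff mod_simps distrib_right)
  show "(0 :: 'a padic_int) \<noteq> 1"
  proof
    assume "(0 :: 'a padic_int) = 1"
    then have "Rep_padic_int (0 :: 'a padic_int) 1 = Rep_padic_int (1 :: 'a padic_int) 1" by simp
    moreover have "int CARD('a) > 1"
      using prime_card[where 'a = 'a] prime_gt_1_nat by auto
    ultimately show False
      by (simp add: zero_padic_int.rep_eq one_padic_int.rep_eq)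
  qed
qed

end

lemma Rep_padic_int_of_nat:
  "Rep_padic_int (of_nat m :: 'p::prime_card padic_int) n = int m mod int CARD('p) ^ n"
  by (induction m) (simp_all add: zero_padic_int.rep_eq one_padic_int.rep_eq
      plus_padic_int.rep_eq mod_simps)

lemma Rep_padic_int_range: "Rep_padic_int (x :: 'p::prime_card padic_int) n \<in> {0..<int CARD('p) ^ n}"
  using Rep_padic_int[of x] by blast

lemma Rep_padic_int_mod:
  "Rep_padic_int (x :: 'p::prime_card padic_int) (n + m) mod int CARD('p) ^ n = Rep_padic_int x n"
proof (induction m)
  case 0
  show ?case using Rep_padic_int_range[of x n] by simp
next
  case (Suc m)
  have "Rep_padic_int x (Suc (n + m)) mod int CARD('p) ^ (n + m) = Rep_padic_int x (n + m)"
    using Rep_padic_int[of x] by blast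
  then show ?case
    using Suc by (metis add_Suc_right le_add1 le_imp_power_dvd mod_mod_cancel)
qed

instance padic_int :: (prime_card) "{idom, ring_char_0}"
proof
  fix a b :: "'a padic_int"
  let ?p = "int CARD('a)"
  assume "a \<noteq> 0" "b \<noteq> 0"
  then obtain m n where m: "Rep_padic_int a m \<noteq> 0" and n: "Rep_padic_int b n \<noteq> 0"
    by (metis Rep_padic_int_inject mod_0 zero_padic_int.rep_eq ext)
  show "a * b \<noteq> 0"
  proof
    assume "a * b = 0"
    then have "Rep_padic_int (a * b) (m + n) = 0"
      by (simp add: zero_padic_int.rep_eq)
    then have "?p ^ (m + n) dvd Rep_padic_int a (m + n) * Rep_padic_int b (m + n)"
      by (simp add: times_padic_int.rep_eq mod_0_imp_dvd)
    then have *: "?p ^ (m + n - 1) dvd Rep_padic_int a (m + n) * Rep_padic_int b (m + n)"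
      by (rule power_le_dvd) simp
    have "m + n > 0"
      using m Rep_padic_int_range[of a 0] by (cases m) auto
    moreover have "prime_elem ?p"
      using prime_card_int[where 'a = 'a] by simp
    ultimately have "?p ^ m dvd Rep_padic_int a (m + n) \<or> ?p ^ n dvd Rep_padic_int b (m + n)"
      by (intro prime_elem_power_dvd_cases[OF *]) simp_all
    then show False
      using m n Rep_padic_int_mod[of a m n] Rep_padic_int_mod[of b n m]
      by (auto simp: add.commute dvd_imp_mod_0)
  qed
next
  show "inj (of_nat :: nat \<Rightarrow> 'a padic_int)"
  proof (rule injI)
    fix i j :: nat
    assume eq: "(of_nat i :: 'a padic_int) = of_nat j"
    have "CARD('a) > 1"
      using prime_card[where 'a = 'a] prime_gt_1_nat by auto
    then have lt: "k < CARD('a) ^ (i + j)" if "k \<le> i + j" for k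
      using that power_gt_expt[of "CARD('a)" "i + j"] by linarith
    have "int i mod int CARD('a) ^ (i + j) = int j mod int CARD('a) ^ (i + j)"
      using eq by (metis Rep_padic_int_of_nat)
    then have "i mod CARD('a) ^ (i + j) = j mod CARD('a) ^ (i + j)"
      by (metis of_nat_eq_iff of_nat_mod of_nat_power)
    then show "i = j"
      using lt[of i] lt[of j] by simp
  qed
qed


section \<open>The $p$-adic numbers\<close>

instance fract :: ("{idom, ring_char_0}") ring_char_0
proof
  show "inj (of_nat :: nat \<Rightarrow> 'a fract)"
    by (rule injI) (simp add: of_nat_fract eq_fract)
qed

instance fract :: ("{idom, ring_char_0}") field_char_0 ..

type_synonym 'p padic = "'p padic_int fract"

text \<open>
  The subring $\mathbb{Z}_p$ of $\mathbb{Q}_p$. Working inside the field lets the library's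
  \<open>/\<close>, \<open>pochhammer\<close> and \<open>fact\<close> be used.
\<close>

definition Zp :: "'p::prime_card padic set" where
  "Zp = range to_fract"

text \<open>
  The congruence $x \equiv y \pmod{p^n}$ is meant for $p$-adic integers only, so it includes the
  membership of both sides in $\mathbb{Z}_p$.
\<close>

definition padic_cong :: "nat \<Rightarrow> 'p::prime_card padic \<Rightarrow> 'p padic \<Rightarrow> bool" where
  "padic_cong n x y \<longleftrightarrow>
     x \<in> Zp \<and> y \<in> Zp \<and> (\<exists>w\<in>Zp. x - y = of_nat CARD('p) ^ n * w)"

text \<open>
  $\langle x\rangle_p$; well defined on $\mathbb{Z}_p$ by \<open>padic_residue_ex1\<close> below.
\<close>

definition padic_residue :: "'p::prime_card padic \<Rightarrow> nat" where
  "padic_residue x = (THE r. r < CARD('p) \<and> padic_cong 1 x (of_nat r))"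

lemma to_fract_of_nat: "to_fract (of_nat n) = of_nat n"
  by (induction n) simp_all

lemma to_fract_power: "to_fract (x ^ n) = to_fract x ^ n"
  by (induction n) simp_all

lemma padic_int_power_dvd_iff:
  fixes y :: "'p::prime_card padic_int"
  shows "of_nat CARD('p) ^ n dvd y \<longleftrightarrow> Rep_padic_int y n = 0"
proof
  assume "of_nat CARD('p) ^ n dvd y"
  then obtain w where y: "y = of_nat (CARD('p) ^ n) * w"
    by (auto elim: dvdE)
  show "Rep_padic_int y n = 0"
    unfolding y times_padic_int.rep_eq Rep_padic_int_of_nat by simp
next
  assume 0: "Rep_padic_int y n = 0"
  let ?p = "int CARD('p)"
  have dvd: "?p ^ n dvd Rep_padic_int y (n + k)" for k
    using Rep_padic_int_mod[of y n k] 0 by (simp add: mod_0_imp_dvd)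
  define w where "w k = Rep_padic_int y (n + k) div ?p ^ n" for k
  have w: "?p ^ n * w k = Rep_padic_int y (n + k)" for k
    using dvd[of k] by (simp add: w_def)
  have range: "w k \<in> {0..<?p ^ k}" for k
  proof -
    have "0 \<le> ?p ^ n * w k" "?p ^ n * w k < ?p ^ n * ?p ^ k"
      unfolding w using Rep_padic_int_range[of y "n + k"] by (auto simp: power_add)
    then show ?thesis
      by (metis atLeastLessThan_iff mult_less_cancel_left_pos prime_card_pos
          zero_le_mult_iff linorder_not_less)
  qed
  have compat: "w (Suc k) mod ?p ^ k = w k" for k
  proof -
    have "?p ^ n * (w (Suc k) mod ?p ^ k) = ?p ^ n * w (Suc k) mod (?p ^ n * ?p ^ k)"
      by (rule mult_mod_right)
    also have "\<dots> = Rep_padic_int y (n + Suc k) mod ?p ^ (n + k)"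
      unfolding w power_add ..
    also have "\<dots> = ?p ^ n * w k"
      unfolding w using Rep_padic_int_mod[of y "n + k" 1] by simp
    finally have "?p ^ n * (w (Suc k) mod ?p ^ k) = ?p ^ n * w k" .
    then show ?thesis by (metis mult_cancel_left prime_card_pos less_irrefl)
  qed
  have Rep_w: "Rep_padic_int (Abs_padic_int w :: 'p padic_int) = w"
    by (rule Abs_padic_int_inverse) (use range compat in blast)
  have "Rep_padic_int (of_nat (CARD('p) ^ n) * Abs_padic_int w :: 'p padic_int) k = Rep_padic_int y k" for k
  proof -
    have "Rep_padic_int (of_nat (CARD('p) ^ n) * Abs_padic_int w :: 'p padic_int) k
          = (?p ^ n * w k) mod ?p ^ k"
      unfolding times_padic_int.rep_eq Rep_padic_int_of_nat Rep_w
      by (simp only: mod_mult_left_eq of_nat_power)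
    also have "\<dots> = Rep_padic_int y k"
      unfolding w using Rep_padic_int_mod[of y k n] by (simp add: add.commute)
    finally show ?thesis .
  qed
  then have "of_nat CARD('p) ^ n * (Abs_padic_int w :: 'p padic_int) = y"
    by (metis Rep_padic_int_inject ext of_nat_power)
  then show "of_nat CARD('p) ^ n dvd y" by (metis dvd_triv_left)
qed

lemma padic_cong_to_fract_iff:
  fixes a b :: "'p::prime_card padic_int"
  shows "padic_cong n (to_fract a) (to_fract b) \<longleftrightarrow> of_nat CARD('p) ^ n dvd a - b"
proof -
  have "to_fract a - to_fract b = of_nat CARD('p) ^ n * to_fract w
        \<longleftrightarrow> a - b = of_nat CARD('p) ^ n * w" for w
    by (metis to_fract_diff to_fract_eq_iff to_fract_mult to_fract_of_nat to_fract_power)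
  then show ?thesis
    unfolding padic_cong_def Zp_def dvd_def by auto
qed

lemma padic_residue_ex1:
  fixes x :: "'p::prime_card padic"
  assumes "x \<in> Zp"
  shows "\<exists>!r. r < CARD('p) \<and> padic_cong 1 x (of_nat r)"
proof -
  obtain y :: "'p padic_int" where x: "x = to_fract y"
    using assms by (auto simp: Zp_def)
  have y: "Rep_padic_int y 1 \<in> {0..<int CARD('p)}"
    using Rep_padic_int_range[of y 1] by simp
  have iff: "r < CARD('p) \<and> padic_cong 1 x (of_nat r) \<longleftrightarrow> int r = Rep_padic_int y 1" for r
  proof -
    have "padic_cong 1 x (of_nat r) \<longleftrightarrow> Rep_padic_int (y - of_nat r) 1 = 0"
      using padic_cong_to_fract_iff[of 1 y "of_nat r"] padic_int_power_dvd_iff[of 1 "y - of_nat r"]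
      by (simp add: x to_fract_of_nat)
    also have "\<dots> \<longleftrightarrow> (Rep_padic_int y 1 - int r) mod int CARD('p) = 0"
      by (simp add: minus_padic_int.rep_eq Rep_padic_int_of_nat[of r 1, simplified] mod_simps)
    also have "\<dots> \<longleftrightarrow> Rep_padic_int y 1 mod int CARD('p) = int r mod int CARD('p)"
      by (simp add: mod_eq_dvd_iff mod_eq_0_iff_dvd)
    finally have "padic_cong 1 x (of_nat r) \<longleftrightarrow> Rep_padic_int y 1 = int r mod int CARD('p)"
      using y by simp
    moreover have "int r mod int CARD('p) = int r" if "r < CARD('p)"
      using that by simp
    moreover have "r < CARD('p)" if "int r = Rep_padic_int y 1"
      using y that by (metis atLeastLessThan_iff of_nat_less_iff)
    ultimately show ?thesis by metis
  qed
  have "int (nat (Rep_padic_int y 1)) = Rep_padic_int y 1"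
    using y by (metis atLeastLessThan_iff int_nat_eq)
  then show ?thesis
    unfolding iff by (metis of_nat_eq_iff)
qed


section \<open>Truncated hypergeometric series\<close>

definition hyp2F1_trunc :: "'a::field_char_0 \<Rightarrow> 'a \<Rightarrow> 'a \<Rightarrow> 'a \<Rightarrow> nat \<Rightarrow> 'a" where
  "hyp2F1_trunc a b c z n =
     (\<Sum>k=0..n. pochhammer a k * pochhammer b k / pochhammer c k * (z ^ k / fact k))"

end

theory Submission
  imports Defs
begin

text \<open>
  Let \<open>a\<close> be the residue of \<open>-\<alpha>\<close> and write \<open>\<alpha> = -a + p t\<close>. Modulo \<open>p\<^sup>2\<close> both sides are affine in \<open>t\<close>,
  so it suffices to compare them at \<open>t = 0\<close> and \<open>t = 1\<close>. There \<open>\<alpha> = -a\<close>, respectively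
  \<open>1 - \<alpha> = -(p - 1 - a)\<close>; since \<open>a\<close> and \<open>p - 1 - a\<close> are even and the series are symmetric under
  \<open>\<alpha> \<mapsto> 1 - \<alpha>\<close>, both series terminate before \<open>p\<close>, and the classical quadratic transformation
  holds exactly: both sides are polynomial solutions in \<open>z\<close> of the same hypergeometric differential
  equation with value 1 at 0.
\<close>

hide_const (open) up_ring.monom up_ring.coeff module.smult

section \<open>The quadratic transformation of a terminating series\<close>

text \<open>Viewing the series as a polynomial in z makes differentiation and composition available.
  One of the two factorials in the denominator is \<open>pochhammer 1 k\<close>.\<close>

definition hyp2F1_poly :: "'a::field_char_0 \<Rightarrow> 'a \<Rightarrow> nat \<Rightarrow> 'a poly" where
  "hyp2F1_poly a b n = (\<Sum>k\<le>n. monom (pochhammer a k * pochhammer b k / fact k ^ 2) k)"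

lemma poly_hyp2F1_poly: "poly (hyp2F1_poly a b n) z = hyp2F1_trunc a b 1 z n"
  unfolding hyp2F1_poly_def hyp2F1_trunc_def poly_sum poly_monom
  by (simp add: atMost_atLeast0 pochhammer_fact[symmetric] power2_eq_square)

text \<open>A vanishing Pochhammer symbol stays zero for all larger indices, so the truncation cuts
  off nothing. The formula for every k, including k > n, is what makes the coefficient recurrence
  hold at the top degree too.\<close>

lemma coeff_hyp2F1_poly:
  assumes "pochhammer a (Suc n) = 0"
  shows "coeff (hyp2F1_poly a b n) k = pochhammer a k * pochhammer b k / fact k ^ 2"
proof (cases "k \<le> n")
  case True
  then show ?thesis by (simp add: hyp2F1_poly_def coeff_sum)
next
  case False
  then have "pochhammer a k = 0"
    using assms pochhammer_eq_0_mono[of a "Suc n" k] by simp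
  with False show ?thesis by (simp add: hyp2F1_poly_def coeff_sum)
qed

text \<open>Euler's hypergeometric equation z(1-z)y'' + (c - (a+b+1)z)y' = ab y with c = 1.\<close>

definition hyp2F1_ode :: "'a::field_char_0 \<Rightarrow> 'a \<Rightarrow> 'a poly \<Rightarrow> bool" where
  "hyp2F1_ode a b y \<longleftrightarrow>
     [:0, 1, -1:] * pderiv (pderiv y) + [:1, - (a + b + 1):] * pderiv y = smult (a * b) y"

text \<open>At z^k, the terms z y'' and y' give k(k+1) + (k+1) = (k+1)^2 times the next coefficient;
  the other terms give k(k-1) + (a+b+1)k + ab = (a+k)(b+k).\<close>

lemma hyp2F1_ode_iff_coeff:
  "hyp2F1_ode a b y \<longleftrightarrow>
     (\<forall>k. of_nat (Suc k) ^ 2 * coeff y (Suc k) = (a + of_nat k) * (b + of_nat k) * coeff y k)"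
proof -
  have "coeff ([:0, 1, -1:] * pderiv (pderiv y) + [:1, - (a + b + 1):] * pderiv y) k
          - coeff (smult (a * b) y) k
        = of_nat (Suc k) ^ 2 * coeff y (Suc k) - (a + of_nat k) * (b + of_nat k) * coeff y k" for k
    \<comment> \<open>The quadratic factor shifts coefficients by up to two places, so k = 0, k = 1
      and k >= 2 are treated apart.\<close>
    by (cases k; cases "k - 1")
       (simp_all add: coeff_pderiv coeff_pCons algebra_simps power2_eq_square)
  then show ?thesis
    unfolding hyp2F1_ode_def poly_eq_iff by (metis eq_iff_diff_eq_0)
qed

lemma hyp2F1_ode_hyp2F1_poly:
  assumes "pochhammer a (Suc n) = 0"
  shows "hyp2F1_ode a b (hyp2F1_poly a b n)"
  unfolding hyp2F1_ode_iff_coeff coeff_hyp2F1_poly[OF assms]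
  by (auto simp: pochhammer_Suc power_mult_distrib field_simps simp del: of_nat_Suc)

text \<open>In characteristic 0 the factor (k+1)^2 of the recurrence can be cancelled, so the
  constant term determines all the others.\<close>

lemma hyp2F1_ode_unique:
  assumes "hyp2F1_ode a b y" "hyp2F1_ode a b y'" "coeff y 0 = coeff y' 0"
  shows "y = y'"
proof (rule poly_eqI)
  fix k show "coeff y k = coeff y' k"
  proof (induction k)
    case (Suc k)
    then have "of_nat (Suc k) ^ 2 * coeff y (Suc k) = of_nat (Suc k) ^ 2 * coeff y' (Suc k)"
      using assms(1,2) unfolding hyp2F1_ode_iff_coeff by metis
    then show ?case by (simp del: of_nat_Suc)
  qed (use assms in simp)
qed

text \<open>With w = 4z(1-z), the equation in z for parameters a, b is 4 times the equation in w for
  a/2, b/2. The condition a + b = 1 fixes the first-order coefficients as 1 - 2z and 1 -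
  (3/2)w.\<close>

lemma hyp2F1_ode_pcompose_quadratic:
  fixes g :: "'a::field_char_0 poly"
  assumes "hyp2F1_ode (a / 2) (b / 2) g" "a + b = 1"
  shows "hyp2F1_ode a b (g \<circ>\<^sub>p [:0, 4, -4:])"
proof -
  let ?w = "[:0, 4, -4:] :: 'a poly"
  define g0 g1 g2 where "g0 = g \<circ>\<^sub>p ?w" "g1 = pderiv g \<circ>\<^sub>p ?w" "g2 = pderiv (pderiv g) \<circ>\<^sub>p ?w"
  note g = this
  have "a / 2 + b / 2 + 1 = 3 / 2"
    using assms(2) by (simp add: add_divide_distrib[symmetric])
  then have "[:0, 1, -1:] * pderiv (pderiv g) + [:1, - (3 / 2):] * pderiv g = smult (a * b / 4) g"
    using assms(1) unfolding hyp2F1_ode_def by (simp only: times_divide_times_eq) simp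
  then have "([:0, 1, -1:] * pderiv (pderiv g) + [:1, - (3 / 2):] * pderiv g) \<circ>\<^sub>p ?w
      = smult (a * b / 4) g \<circ>\<^sub>p ?w" by simp
  then have eq: "smult 4 (([:0, 1, -1:] \<circ>\<^sub>p ?w) * g2 + ([:1, - (3 / 2):] \<circ>\<^sub>p ?w) * g1) = smult (a * b) g0"
    by (simp add: pcompose_add pcompose_mult pcompose_smult g del: mult_pCons_left mult_pCons_right)
  \<comment> \<open>The factor \<open>[:4, -8:]\<close> is w', from the chain rule.\<close>
  have d1: "pderiv g0 = g1 * [:4, -8:]"
    by (simp add: g pderiv_pcompose pderiv_pCons)
  have "pderiv g1 = g2 * [:4, -8:]" "pderiv [:4, -8 :: 'a:] = [:-8:]"
    by (simp_all add: g pderiv_pcompose pderiv_pCons)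
  then have d2: "pderiv (pderiv g0) = g2 * [:4, -8:] ^ 2 + g1 * [:-8:]"
    unfolding d1 pderiv_mult by (simp only: power2_eq_square ac_simps)
  \<comment> \<open>This rests on z(1-z)w'^2 = 4w(1-w), which comes from 1-w = (1-2z)^2, and on
    z(1-z)w'' + (1-2z)w' = 4(1 - (3/2)w).\<close>
  have "[:0, 1, -1:] * pderiv (pderiv g0) + [:1, -2:] * pderiv g0
      = smult 4 (([:0, 1, -1:] \<circ>\<^sub>p ?w) * g2 + ([:1, - (3 / 2):] \<circ>\<^sub>p ?w) * g1)"
    unfolding d2 unfolding d1
    by (simp add: poly_eq_poly_eq_iff[symmetric] fun_eq_iff poly_pcompose power2_eq_square
        algebra_simps del: mult_pCons_left mult_pCons_right)
  then show ?thesis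
    using eq assms(2) unfolding hyp2F1_ode_def g(1) by simp
qed

lemma hyp2F1_trunc_quadratic:
  fixes a b z :: "'a::field_char_0"
  assumes "a + b = 1" "pochhammer a (Suc n) = 0" "pochhammer (a / 2) (Suc n) = 0"
  shows "hyp2F1_trunc a b 1 z n = hyp2F1_trunc (a / 2) (b / 2) 1 (4 * z * (1 - z)) n"
proof -
  have "hyp2F1_poly a b n = hyp2F1_poly (a / 2) (b / 2) n \<circ>\<^sub>p [:0, 4, -4:]"
  proof (rule hyp2F1_ode_unique)
    show "hyp2F1_ode a b (hyp2F1_poly a b n)"
      using assms(2) by (rule hyp2F1_ode_hyp2F1_poly)
    show "hyp2F1_ode a b (hyp2F1_poly (a / 2) (b / 2) n \<circ>\<^sub>p [:0, 4, -4:])"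
      by (intro hyp2F1_ode_pcompose_quadratic hyp2F1_ode_hyp2F1_poly assms)
    \<comment> \<open>The inner quadratic vanishes at 0, so composition preserves the constant term,
      which is 1 for both series.\<close>
    show "coeff (hyp2F1_poly a b n) 0 = coeff (hyp2F1_poly (a / 2) (b / 2) n \<circ>\<^sub>p [:0, 4, -4:]) 0"
      by (simp add: pcompose_coeff_0 poly_0_coeff_0 coeff_hyp2F1_poly assms)
  qed
  then have "poly (hyp2F1_poly a b n) z = poly (hyp2F1_poly (a / 2) (b / 2) n) (poly [:0, 4, -4:] z)"
    by (simp only: poly_pcompose)
  then show ?thesis
    by (simp add: poly_hyp2F1_poly algebra_simps)
qed

lemma hyp2F1_trunc_commute: "hyp2F1_trunc a b c z n = hyp2F1_trunc b a c z n"
  by (simp add: hyp2F1_trunc_def mult.commute)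

section \<open>Units and subring structure of the \<open>p\<close>-adic integers\<close>

text \<open>Inverses of k modulo each p^n are unique, hence compatible, and so they assemble into a
  p-adic integer.\<close>

lemma padic_int_of_nat_unit:
  assumes "coprime k CARD('p::prime_card)"
  shows "\<exists>y :: 'p padic_int. of_nat k * y = 1"
proof -
  let ?p = "int CARD('p)"
  have cop: "coprime (int k) (?p ^ n)" for n
    using assms by (simp add: coprime_power_right_iff)
  have "\<exists>x. [int k * x = 1] (mod ?p ^ n)" for n
    using cong_solve_coprime_int[OF cop] by blast
  then obtain f where f: "[int k * f n = 1] (mod ?p ^ n)" for n
    by metis
  \<comment> \<open>Both sides are inverses of k modulo p^n, and k can be cancelled there.\<close>
  have "[f (Suc n) = f n] (mod ?p ^ n)" for n
  proof -
    have "[int k * f (Suc n) = 1] (mod ?p ^ n)"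
      using f[of "Suc n"] by (rule cong_dvd_modulus) simp
    then have "[int k * f (Suc n) = int k * f n] (mod ?p ^ n)"
      using f[of n] by (metis cong_sym cong_trans)
    then show ?thesis
      using cong_mult_lcancel[OF cop] by blast
  qed
  note fam = mod_family_padic[of f, OF this]
  define y :: "'p padic_int" where "y = Abs_padic_int (\<lambda>n. f n mod ?p ^ n)"
  have Rep: "Rep_padic_int y = (\<lambda>n. f n mod ?p ^ n)"
    unfolding y_def by (rule Abs_padic_int_inverse) (use fam in blast)
  have "Rep_padic_int (of_nat k * y) n = Rep_padic_int (1 :: 'p padic_int) n" for n
    using f[of n] by (simp add: times_padic_int.rep_eq one_padic_int.rep_eq Rep
        Rep_padic_int_of_nat mod_simps cong_def)
  then have "of_nat k * y = 1"
    by (metis Rep_padic_int_inject ext)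
  then show ?thesis ..
qed

lemma Zp_add [intro]: "x \<in> Zp \<Longrightarrow> y \<in> Zp \<Longrightarrow> x + y \<in> Zp"
  unfolding Zp_def by (auto simp flip: to_fract_add)

lemma Zp_diff [intro]: "x \<in> Zp \<Longrightarrow> y \<in> Zp \<Longrightarrow> x - y \<in> Zp"
  unfolding Zp_def by (auto simp flip: to_fract_diff)

lemma Zp_mult [intro]: "x \<in> Zp \<Longrightarrow> y \<in> Zp \<Longrightarrow> x * y \<in> Zp"
  unfolding Zp_def by (auto simp flip: to_fract_mult)

lemma Zp_of_nat [intro, simp]: "of_nat n \<in> Zp"
  unfolding Zp_def by (metis rangeI to_fract_of_nat)

lemma Zp_0 [intro, simp]: "0 \<in> Zp" and Zp_1 [intro, simp]: "1 \<in> Zp"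
  using Zp_of_nat[of 0] Zp_of_nat[of 1] by simp_all

lemma Zp_numeral [intro, simp]: "numeral n \<in> Zp"
  using Zp_of_nat[of "numeral n"] by simp

lemma Zp_uminus [intro]: "x \<in> Zp \<Longrightarrow> - x \<in> Zp"
  using Zp_diff[of 0 x] by simp

lemma Zp_power [intro]: "x \<in> Zp \<Longrightarrow> x ^ n \<in> Zp"
  by (induction n) auto

lemma Zp_inverse_of_nat:
  assumes "coprime k CARD('p::prime_card)"
  shows "inverse (of_nat k) \<in> (Zp :: 'p padic set)"
proof -
  obtain y :: "'p padic_int" where "of_nat k * y = 1"
    using padic_int_of_nat_unit[OF assms] by blast
  then have "of_nat k * to_fract y = 1"
    by (metis to_fract_1 to_fract_mult to_fract_of_nat)
  then show ?thesis
    unfolding Zp_def by (metis inverse_unique rangeI)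
qed

text \<open>The reason for truncating at p - 1: p divides no k! with k < p, so all denominators of
  the series are units.\<close>

lemma Zp_inverse_fact:
  assumes "k < CARD('p::prime_card)"
  shows "inverse (fact k) \<in> (Zp :: 'p padic set)"
proof -
  have "coprime (fact k) CARD('p)"
    using assms prime_card[where 'a = 'p]
    by (metis coprime_commute prime_dvd_fact_iff prime_imp_coprime not_le)
  from Zp_inverse_of_nat[OF this] show ?thesis by simp
qed

section \<open>Functions that are affine modulo \<open>p\<^sup>2\<close>\<close>

text \<open>A first-order expansion in pt: A and B are chosen once for all t, and only the error may
  vary with t. Since (pt)^2 is absorbed by p^2, such functions are closed under products, hence
  contain the truncated series.\<close>

definition affine_mod :: "('p::prime_card padic \<Rightarrow> 'p padic) \<Rightarrow> bool" where
  "affine_mod f \<longleftrightarrow> (\<exists>A\<in>Zp. \<exists>B\<in>Zp. \<forall>t\<in>Zp. \<exists>e\<in>Zp.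
     f t = A + of_nat CARD('p) * t * B + of_nat CARD('p) ^ 2 * e)"

lemma affine_modI:
  fixes f :: "'p::prime_card padic \<Rightarrow> 'p padic"
  assumes "A \<in> Zp" "B \<in> Zp" "\<And>t. t \<in> Zp \<Longrightarrow> e t \<in> Zp"
    and "\<And>t. t \<in> Zp \<Longrightarrow> f t = A + of_nat CARD('p) * t * B + of_nat CARD('p) ^ 2 * e t"
  shows "affine_mod f"
  unfolding affine_mod_def using assms by blast

lemma affine_modE:
  fixes f :: "'p::prime_card padic \<Rightarrow> 'p padic"
  assumes "affine_mod f"
  obtains A B e where "A \<in> Zp" "B \<in> Zp" "\<And>t. t \<in> Zp \<Longrightarrow> e t \<in> Zp"
    and "\<And>t. t \<in> Zp \<Longrightarrow> f t = A + of_nat CARD('p) * t * B + of_nat CARD('p) ^ 2 * e t"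
proof -
  from assms obtain A B where "A \<in> Zp" "B \<in> Zp" and
    "\<forall>t\<in>Zp. \<exists>e\<in>Zp. f t = A + of_nat CARD('p) * t * B + of_nat CARD('p) ^ 2 * e"
    unfolding affine_mod_def by blast
  with that show thesis by metis
qed

lemma affine_mod_const: "c \<in> Zp \<Longrightarrow> affine_mod (\<lambda>t. c)"
  by (rule affine_modI[of c 0 "\<lambda>_. 0"]) auto

lemma affine_mod_p_mult: "affine_mod (\<lambda>t :: 'p::prime_card padic. of_nat CARD('p) * t)"
  by (rule affine_modI[of 0 1 "\<lambda>_. 0"]) auto

lemma affine_mod_add:
  fixes f g :: "'p::prime_card padic \<Rightarrow> 'p padic"
  assumes "affine_mod f" "affine_mod g"
  shows "affine_mod (\<lambda>t. f t + g t)"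
proof -
  from assms(1) obtain A B e where f: "A \<in> Zp" "B \<in> Zp" "\<And>t. t \<in> Zp \<Longrightarrow> e t \<in> Zp"
    "\<And>t. t \<in> Zp \<Longrightarrow> f t = A + of_nat CARD('p) * t * B + of_nat CARD('p) ^ 2 * e t"
    by (rule affine_modE) blast
  from assms(2) obtain A' B' e' where g: "A' \<in> Zp" "B' \<in> Zp" "\<And>t. t \<in> Zp \<Longrightarrow> e' t \<in> Zp"
    "\<And>t. t \<in> Zp \<Longrightarrow> g t = A' + of_nat CARD('p) * t * B' + of_nat CARD('p) ^ 2 * e' t"
    by (rule affine_modE) blast
  show ?thesis
    by (rule affine_modI[of "A + A'" "B + B'" "\<lambda>t. e t + e' t"])
       (use f g in \<open>auto simp: algebra_simps\<close>)
qed

lemma affine_mod_mult: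
  fixes f g :: "'p::prime_card padic \<Rightarrow> 'p padic"
  assumes "affine_mod f" "affine_mod g"
  shows "affine_mod (\<lambda>t. f t * g t)"
proof -
  let ?p = "of_nat CARD('p) :: 'p padic"
  from assms(1) obtain A B e where f: "A \<in> Zp" "B \<in> Zp" "\<And>t. t \<in> Zp \<Longrightarrow> e t \<in> Zp"
    "\<And>t. t \<in> Zp \<Longrightarrow> f t = A + ?p * t * B + ?p ^ 2 * e t"
    by (rule affine_modE) blast
  from assms(2) obtain A' B' e' where g: "A' \<in> Zp" "B' \<in> Zp" "\<And>t. t \<in> Zp \<Longrightarrow> e' t \<in> Zp"
    "\<And>t. t \<in> Zp \<Longrightarrow> g t = A' + ?p * t * B' + ?p ^ 2 * e' t"
    by (rule affine_modE) blast
  show ?thesis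
  \<comment> \<open>The slope follows the product rule. The error collects the product of the two
    linear terms, the linear part of f times \<open>e'\<close>, and \<open>e\<close> times all of
    g.\<close>
  proof (rule affine_modI[of "A * A'" "A * B' + B * A'"
        "\<lambda>t. t * t * B * B' + (A + ?p * t * B) * e' t + e t * g t"])
    fix t :: "'p padic" assume t: "t \<in> Zp"
    show "t * t * B * B' + (A + ?p * t * B) * e' t + e t * g t \<in> Zp"
      using f(1,2) f(3)[OF t] g(1,2) g(3)[OF t] t unfolding g(4)[OF t]
      by (intro Zp_add Zp_mult Zp_power Zp_of_nat)
    show "f t * g t = A * A' + ?p * t * (A * B' + B * A')
        + ?p ^ 2 * (t * t * B * B' + (A + ?p * t * B) * e' t + e t * g t)"
      unfolding f(4)[OF t] g(4)[OF t] by (simp add: algebra_simps power2_eq_square)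
  qed (use f(1,2) g(1,2) in auto)
qed

lemma affine_mod_pochhammer:
  assumes "affine_mod f"
  shows "affine_mod (\<lambda>t. pochhammer (f t) k)"
  by (induction k)
     (auto simp: pochhammer_Suc intro!: affine_mod_mult affine_mod_add affine_mod_const assms)

lemma affine_mod_sum:
  assumes "\<And>i. i \<in> I \<Longrightarrow> affine_mod (f i)"
  shows "affine_mod (\<lambda>t. \<Sum>i\<in>I. f i t)"
  using assms
  by (induction I rule: infinite_finite_induct) (auto intro!: affine_mod_const affine_mod_add)

lemma affine_mod_hyp2F1_trunc:
  fixes f g :: "'p::prime_card padic \<Rightarrow> 'p padic"
  assumes "affine_mod f" "affine_mod g" "z \<in> Zp" "n < CARD('p)"
  shows "affine_mod (\<lambda>t. hyp2F1_trunc (f t) (g t) 1 z n)"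
  unfolding hyp2F1_trunc_def divide_inverse pochhammer_fact[symmetric]
  by (intro affine_mod_sum affine_mod_mult affine_mod_pochhammer affine_mod_const assms
      Zp_mult Zp_power Zp_inverse_fact) (use assms(4) in auto)

text \<open>Two values determine an affine function: t = 0 forces the intercepts to agree modulo
  p^2, and t = 1 then forces p(B - B') to vanish modulo p^2.\<close>

lemma padic_cong_affine_mod:
  fixes f g :: "'p::prime_card padic \<Rightarrow> 'p padic"
  assumes "affine_mod f" "affine_mod g" "f 0 = g 0" "f 1 = g 1" "t \<in> Zp"
  shows "padic_cong 2 (f t) (g t)"
proof -
  let ?p = "of_nat CARD('p) :: 'p padic"
  from assms(1) obtain A B e where f: "A \<in> Zp" "B \<in> Zp" "\<And>t. t \<in> Zp \<Longrightarrow> e t \<in> Zp"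
    "\<And>t. t \<in> Zp \<Longrightarrow> f t = A + ?p * t * B + ?p ^ 2 * e t"
    by (rule affine_modE) blast
  from assms(2) obtain A' B' e' where g: "A' \<in> Zp" "B' \<in> Zp" "\<And>t. t \<in> Zp \<Longrightarrow> e' t \<in> Zp"
    "\<And>t. t \<in> Zp \<Longrightarrow> g t = A' + ?p * t * B' + ?p ^ 2 * e' t"
    by (rule affine_modE) blast
  define d where "d s = e s - e' s" for s
  have d: "d s \<in> Zp" if "s \<in> Zp" for s
    using f(3) g(3) that by (auto simp: d_def)
  have 0: "A - A' = - (?p ^ 2 * d 0)"
    using assms(3) f(4)[of 0] g(4)[of 0] by (simp add: d_def algebra_simps)
  have 1: "A - A' + ?p * (B - B') = - (?p ^ 2 * d 1)"
    using assms(4) f(4)[of 1] g(4)[of 1] by (simp add: d_def algebra_simps)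
  \<comment> \<open>The term p(B - B') is kept whole, as the difference of the conditions at 1 and
    0, so no division by p occurs.\<close>
  have "f t - g t = (A - A') + t * ((A - A' + ?p * (B - B')) - (A - A')) + ?p ^ 2 * d t"
    using f(4)[OF assms(5)] g(4)[OF assms(5)] by (simp add: d_def algebra_simps)
  also have "\<dots> = ?p ^ 2 * (- d 0 + t * (d 0 - d 1) + d t)"
    unfolding 1 unfolding 0 by (simp add: algebra_simps)
  finally have eq: "f t - g t = ?p ^ 2 * (- d 0 + t * (d 0 - d 1) + d t)" .
  have "f t \<in> Zp" "g t \<in> Zp"
    using f(1,2) f(3)[OF assms(5)] g(1,2) g(3)[OF assms(5)] assms(5)
    unfolding f(4)[OF assms(5)] g(4)[OF assms(5)]
    by (auto intro!: Zp_add Zp_mult Zp_power)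
  moreover have "- d 0 + t * (d 0 - d 1) + d t \<in> Zp"
    using assms(5) by (intro Zp_add Zp_mult Zp_diff Zp_uminus d) auto
  ultimately show ?thesis
    unfolding padic_cong_def using eq by blast
qed

section \<open>Exact identities at even nonpositive integers, and the congruence\<close>

lemma hyp2F1_trunc_quadratic_neg_even:
  fixes z :: "'a::field_char_0"
  assumes "even a" "a \<le> n" "x = - of_nat a"
  shows "hyp2F1_trunc x (1 - x) 1 z n
       = hyp2F1_trunc (1/2 * x) (1/2 - 1/2 * x) 1 (4 * z * (1 - z)) n"
proof -
  obtain m where m: "a = 2 * m" using assms(1) by blast
  \<comment> \<open>Evenness makes the halved parameter a nonpositive integer as well, so the series
    on the right also terminates by index n.\<close>
  have "x / 2 = - of_nat m" by (simp add: assms(3) m)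
  then have "pochhammer x (Suc n) = 0" "pochhammer (x / 2) (Suc n) = 0"
    using assms(2,3) m pochhammer_of_nat_eq_0_lemma[of a "Suc n"]
      pochhammer_of_nat_eq_0_lemma[of m "Suc n"] by simp_all
  from hyp2F1_trunc_quadratic[OF _ this, of "1 - x" z] show ?thesis
    by (simp add: diff_divide_distrib)
qed

theorem theorem2p1:
  fixes \<alpha> z :: "'p::prime_card padic"
  assumes "odd CARD('p)"
    and "\<alpha> \<in> Zp"
    and "even (padic_residue (- \<alpha>))"
    and "z \<in> Zp"
  shows "padic_cong 2
           (hyp2F1_trunc \<alpha> (1 - \<alpha>) 1 z (CARD('p) - 1))
           (hyp2F1_trunc (1/2 * \<alpha>) (1/2 - 1/2 * \<alpha>) 1 (4 * z * (1 - z)) (CARD('p) - 1))"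
proof -
  let ?p = "of_nat CARD('p) :: 'p padic" and ?n = "CARD('p) - 1"
  define a where "a = padic_residue (- \<alpha>)"
  have "a < CARD('p) \<and> padic_cong 1 (- \<alpha>) (of_nat a)"
    unfolding a_def padic_residue_def
    by (rule theI') (use assms(2) in \<open>intro padic_residue_ex1 Zp_uminus\<close>)
  then obtain w where a: "a < CARD('p)" and w: "w \<in> Zp" "- \<alpha> - of_nat a = ?p * w"
    by (auto simp: padic_cong_def)
  \<comment> \<open>The line through the values in play: x(0) = -a, x(1) = p - a, and x(-w) =
    \<alpha>.\<close>
  define x where "x t = - of_nat a + ?p * t" for t
  define f where "f t = hyp2F1_trunc (x t) (1 - x t) 1 z ?n" for t
  define g where "g t = hyp2F1_trunc (1/2 * x t) (1/2 - 1/2 * x t) 1 (4 * z * (1 - z)) ?n" for t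
  \<comment> \<open>Since p is odd, 2 is a unit and the halved parameters stay in the p-adic
    integers.\<close>
  have half: "1/2 \<in> (Zp :: 'p padic set)"
    using Zp_inverse_of_nat[where 'p = 'p and k = 2] assms(1) by (simp add: inverse_eq_divide)
  have p: "?n < CARD('p)" using a by simp
  have x: "affine_mod x"
    unfolding x_def by (intro affine_mod_add affine_mod_p_mult affine_mod_const Zp_uminus Zp_of_nat)
  have lin: "affine_mod (\<lambda>t. c + d * x t)" if "c \<in> Zp" "d \<in> Zp" for c d
    by (intro affine_mod_add affine_mod_mult affine_mod_const x that)
  have "affine_mod f"
    unfolding f_def using lin[of 1 "-1"] by (intro affine_mod_hyp2F1_trunc x assms(4) p) auto
  moreover have "affine_mod g"
    unfolding g_def using lin[of "1/2" "-(1/2)"] half assms(4)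
    by (intro affine_mod_hyp2F1_trunc affine_mod_mult affine_mod_const x p Zp_mult Zp_diff) auto
  moreover have "f 0 = g 0"
    unfolding f_def g_def
    by (rule hyp2F1_trunc_quadratic_neg_even[of a]) (use a assms(3) in \<open>auto simp: x_def a_def\<close>)
  moreover have "f 1 = g 1"
  proof -
    \<comment> \<open>At t = 1 it is the other upper parameter that is a nonpositive integer, namely
      -(p - 1 - a).\<close>
    have "1 - x 1 = - of_nat (?n - a)"
      using a by (simp add: x_def of_nat_diff)
    moreover have "even (?n - a)"
      using a assms(1,3) by (simp add: a_def)
    ultimately have "hyp2F1_trunc (1 - x 1) (1 - (1 - x 1)) 1 z ?n
      = hyp2F1_trunc (1/2 * (1 - x 1)) (1/2 - 1/2 * (1 - x 1)) 1 (4 * z * (1 - z)) ?n"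
      by (intro hyp2F1_trunc_quadratic_neg_even[of "?n - a"]) auto
    \<comment> \<open>Replacing x by 1 - x merely swaps the upper parameters, on the halved side
      too.\<close>
    moreover have "1/2 * (1 - x 1) = 1/2 - 1/2 * x 1" "1/2 - 1/2 * (1 - x 1) = 1/2 * x 1"
      by (simp_all add: field_simps)
    ultimately show ?thesis
      unfolding f_def g_def by (simp only: hyp2F1_trunc_commute[of "1 - x 1"]
          hyp2F1_trunc_commute[of "1/2 - 1/2 * x 1"] diff_diff_eq2 add_diff_cancel_left')
  qed
  ultimately have "padic_cong 2 (f (- w)) (g (- w))"
    by (rule padic_cong_affine_mod) (use w in auto)
  moreover have "x (- w) = \<alpha>"
    using w(2)[symmetric] by (simp add: x_def)
  ultimately show ?thesis
    by (simp add: f_def g_def)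
qed

end
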